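(* Let $\frac1p+\frac1q=1$, and let $\widetilde w(y,\boldsymbol{\nu})=\|K(\nabla G(\cdot;y)\cdot\boldsymbol{\nu})\|_{L^p(\partial\Omega)}$. The function $f^*\in BV(\Omega)$ is a minimizer of $$\min_{f\in BV(\Omega)}\ \int_\Omega\widetilde w(y,\boldsymbol{\nu}_f(y))\,d|Df|(y)+\beta\int_{\partial\Omega}w_\partial|f|\,ds\quad\text{subject to}\quad Kf=Kf^*$$ if there exists $\lambda\in L^q(\partial\Omega)$ such that, with the vector field $\boldsymbol{z}_\lambda(y)=\langle\lambda,K(\nabla G(\cdot;y))\rangle$, the following hold: (i) $\|\lambda\|_{L^q(\partial\Omega)}\le1$; (ii) $\boldsymbol{z}_\lambda(y)\cdot\boldsymbol{\nu}_{f^*}(y)=\widetilde w(y,\boldsymbol{\nu}_{f^*}(y))$ for $|Df^*|$-a.e. $y$; (iii) $|\boldsymbol{z}_\lambda(x)\cdot\boldsymbol{n}(x)|\le\beta w_\partial(x)$ for $x\in\partial\Omega$; (iv) $(\boldsymbol{z}_\lambda\cdot\boldsymbol{n})f^*=-\beta w_\partial|f^*|$ on $\partial\Omega$.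
   Context: $\Omega\subset\mathbb{R}^2$ is a bounded Lipschitz domain with outward unit normal $\boldsymbol{n}$, $K:L^2(\Omega)\to L^2(\partial\Omega)$ is a linear operator, $1\le p<\infty$, $\beta\ge0$. For $f\in BV(\Omega)$, $Df$ is the vector-valued Radon measure derivative with polar decomposition $Df=\boldsymbol{\nu}_f|Df|$, $|\boldsymbol{\nu}_f|_2=1$; on $\partial\Omega$, $f$ denotes its BV trace. $\langle\cdot,\cdot\rangle$ is the $L^q$–$L^p$ duality pairing on $\partial\Omega$; in $\boldsymbol{z}_\lambda$ it is applied componentwise, i.e. $\boldsymbol{z}_\lambda(y)\cdot\theta=\langle\lambda,K(\nabla G(\cdot;y)\cdot\theta)\rangle$ for $\theta\in\mathbb{R}^2$. $G$ is a (symmetric) Green's function of the Laplacian. The notation $\nabla G(\cdot;y)$ means the gradient of $G(x;y)$ with respect to $y$, regarded as a function of $x$; likewise $\partial_{\boldsymbol{n}}G(\cdot;y)$ for $y\in\partial\Omega$ is the normal derivative in $y$. $K$ acts on the variable $x$. One of the following settings is used. Dirichlet setting ($\beta\ge0$): $-\Delta_yG(y;x)=\delta_x(y)$ in $\Omega$, $G(y;x)=0$ for $y\in\partial\Omega$, and $w_\partial(y)=\bigl(\int_{\partial\Omega}|K(\partial_{\boldsymbol{n}}G(\cdot;y))(z)|^p\,ds(z)\bigr)^{1/p}$ for $y\in\partial\Omega$. Here $f(x)=\int_\Omega\nabla G(x;y)\cdot\boldsymbol{\nu}_f(y)\,d|Df|(y)-\int_{\partial\Omega}\partial_{\boldsymbol{n}}G(x;y)f(y)\,ds(y)$,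 and on $\partial\Omega$, $\boldsymbol{z}_\lambda\cdot\boldsymbol{n}(y)=\langle\lambda,K(\partial_{\boldsymbol{n}}G(\cdot;y))\rangle$. Neumann setting ($\beta=0$, no boundary term, and $K1=0$ where $1$ is the constant function): $-\Delta_yG(y;x)=\delta_x(y)-\frac1{|\Omega|}$ in $\Omega$, $\nabla_yG(y;x)\cdot\boldsymbol{n}(y)=0$ on $\partial\Omega$. Here $f(x)=\int_\Omega\nabla G(x;y)\cdot\boldsymbol{\nu}_f(y)\,d|Df|(y)+\frac1{|\Omega|}\int_\Omega f\,dy$. Standing convention: $K(\nabla G(\cdot;y)\cdot\boldsymbol{d})\in L^p(\partial\Omega)$ (and $K(\partial_{\boldsymbol{n}}G(\cdot;y))\in L^p(\partial\Omega)$ in the Dirichlet setting) is well defined, measurable in $y$ and linear in $\boldsymbol{d}\in\mathbb{R}^2$, and $K$ and the pairing with $\lambda$ may be interchanged with the integrals in the representation formula for $f$, that is, with the integrals in $f(x)=\int_\Omega\nabla G(x;y)\cdot\boldsymbol{\nu}_f(y)\,d|Df|(y)-\int_{\partial\Omega}\partial_{\boldsymbol{n}}G(x;y)f(y)\,ds(y)$ in the Dirichlet setting, and in $f(x)=\int_\Omega\nabla G(x;y)\cdot\boldsymbol{\nu}_f(y)\,d|Df|(y)+\frac1{|\Omega|}\int_\Omega f\,dy$ in the Neumann setting. *)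

theory Defs
  imports "HOL-Analysis.Analysis" "HOL-Probability.Essential_Supremum"
begin

section \<open>Lebesgue norms\<close>

definition Lp_norm :: "'a measure \<Rightarrow> ennreal \<Rightarrow> ('a \<Rightarrow> real) \<Rightarrow> ennreal" where
  "Lp_norm M r u =
    (if r = \<infinity> then esssup M (\<lambda>x. ennreal \<bar>u x\<bar>)
     else (let I = (\<integral>\<^sup>+ x. ennreal (\<bar>u x\<bar> powr enn2real r) \<partial>M)
           in if I = \<infinity> then \<infinity> else ennreal (enn2real I powr (1 / enn2real r))))"

text \<open>Elements are functions, not equivalence classes.\<close>

definition Lp_space :: "'a measure \<Rightarrow> ennreal \<Rightarrow> ('a \<Rightarrow> real) set" where
  "Lp_space M r = {u \<in> borel_measurable M. Lp_norm M r u < \<infinity>}"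


section \<open>Differential operators and test functions in the plane\<close>

definition grad :: "(real^2 \<Rightarrow> real) \<Rightarrow> real^2 \<Rightarrow> real^2" where
  "grad u x = (THE D. GDERIV u x :> D)"

definition divergence :: "(real^2 \<Rightarrow> real^2) \<Rightarrow> real^2 \<Rightarrow> real" where
  "divergence v x = (\<Sum>i\<in>UNIV. frechet_derivative v (at x) (axis i 1) $ i)"

definition laplacian :: "(real^2 \<Rightarrow> real) \<Rightarrow> real^2 \<Rightarrow> real" where
  "laplacian u = divergence (grad u)"

definition C1_map :: "(real^2 \<Rightarrow> 'b::real_normed_vector) \<Rightarrow> bool" where
  "C1_map v \<longleftrightarrow> (\<forall>x. v differentiable (at x)) \<and>
     (\<forall>h. continuous_on UNIV (\<lambda>x. frechet_derivative v (at x) h))"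

definition compactly_supported_in :: "(real^2) set \<Rightarrow> (real^2 \<Rightarrow> 'b::real_normed_vector) \<Rightarrow> bool" where
  "compactly_supported_in \<Omega> v \<longleftrightarrow> compact (closure {x. v x \<noteq> 0}) \<and> closure {x. v x \<noteq> 0} \<subseteq> \<Omega>"

definition test_fields :: "(real^2) set \<Rightarrow> (real^2 \<Rightarrow> real^2) set" where
  "test_fields \<Omega> = {v. C1_map v \<and> compactly_supported_in \<Omega> v}"

text \<open>Compactly supported functions of class \<open>C\<^sup>2\<close>.\<close>

definition test_functions :: "(real^2) set \<Rightarrow> (real^2 \<Rightarrow> real) set" where
  "test_functions \<Omega> = {u. C1_map u \<and> C1_map (grad u) \<and> compactly_supported_in \<Omega> u}"


section \<open>Lipschitz domains, boundary measure and normal\<close>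

text \<open>Near each boundary point, and in suitable orthonormal coordinates \<open>(s, t)\<close> centred there,
  the domain is the strict epigraph of a Lipschitz function.\<close>

definition bounded_lipschitz_domain :: "(real^2) set \<Rightarrow> bool" where
  "bounded_lipschitz_domain \<Omega> \<longleftrightarrow>
     open \<Omega> \<and> connected \<Omega> \<and> \<Omega> \<noteq> {} \<and> bounded \<Omega> \<and>
     (\<forall>x \<in> frontier \<Omega>. \<exists>u v r h L \<phi>.
        norm u = 1 \<and> norm v = 1 \<and> u \<bullet> v = 0 \<and> 0 < r \<and> 0 < h \<and>
        L-lipschitz_on {-r<..<r} \<phi> \<and>
        (\<forall>y. \<bar>(y - x) \<bullet> u\<bar> < r \<and> \<bar>(y - x) \<bullet> v\<bar> < h \<longrightarrow>
           (y \<in> \<Omega> \<longleftrightarrow> \<phi> ((y - x) \<bullet> u) < (y - x) \<bullet> v)))"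

text \<open>One-dimensional Hausdorff measure; in dimension one the usual normalisation weighs a
  covering set by its diameter, so that it is arc length on curves.\<close>

definition hausdorff1_pre :: "real \<Rightarrow> (real^2) set \<Rightarrow> ennreal" where
  "hausdorff1_pre \<delta> A =
     (INF C \<in> {C :: nat \<Rightarrow> (real^2) set. A \<subseteq> (\<Union>i. C i) \<and> (\<forall>i. bounded (C i) \<and> diameter (C i) \<le> \<delta>)}.
        \<Sum>i. ennreal (diameter (C i)))"

definition hausdorff1 :: "(real^2) measure" where
  "hausdorff1 = measure_of UNIV (sets borel) (\<lambda>A. SUP \<delta>\<in>{0<..}. hausdorff1_pre \<delta> A)"

definition surface_measure :: "(real^2) set \<Rightarrow> (real^2) measure" where
  "surface_measure \<Omega> = completion (restrict_space hausdorff1 (frontier \<Omega>))"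

text \<open>\<open>n\<close> is normal at \<open>y\<close> when all points near \<open>y\<close> that avoid arbitrarily thin double sectors
  around the line orthogonal to \<open>n\<close> lie outside or inside the domain according to the sign of
  \<open>(x - y) \<bullet> n\<close>. For a Lipschitz domain such an \<open>n\<close> exists at almost every boundary point
  (those where the local graph function is differentiable) and is then unique; elsewhere
  the value below is unspecified.\<close>

definition is_outward_normal :: "(real^2) set \<Rightarrow> real^2 \<Rightarrow> real^2 \<Rightarrow> bool" where
  "is_outward_normal \<Omega> y n \<longleftrightarrow> norm n = 1 \<and>
     (\<forall>\<epsilon>>0. \<exists>\<delta>>0. \<forall>x. dist x y < \<delta> \<longrightarrow>
        ((x - y) \<bullet> n > \<epsilon> * norm (x - y) \<longrightarrow> x \<notin> \<Omega>) \<and>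
        ((x - y) \<bullet> n < - \<epsilon> * norm (x - y) \<longrightarrow> x \<in> \<Omega>))"

definition outward_normal :: "(real^2) set \<Rightarrow> real^2 \<Rightarrow> real^2" where
  "outward_normal \<Omega> y = (THE n. is_outward_normal \<Omega> y n)"


section \<open>Functions of bounded variation\<close>

text \<open>Finite \<open>\<real>\<^sup>2\<close>-valued Borel measures on \<open>\<Omega>\<close>, their total variation \<open>\<bar>D\<bar>\<close> and the
  unit density \<open>\<nu>\<close> in the polar decomposition \<open>D = \<nu> \<bar>D\<bar>\<close>.\<close>

definition vector_measure :: "(real^2) set \<Rightarrow> ((real^2) set \<Rightarrow> real^2) \<Rightarrow> bool" where
  "vector_measure \<Omega> D \<longleftrightarrow>
     (\<forall>A :: nat \<Rightarrow> (real^2) set. range A \<subseteq> sets (restrict_space borel \<Omega>) \<and> disjoint_family A \<longrightarrow>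
        (\<lambda>i. D (A i)) sums D (\<Union>i. A i))"

definition variation_measure :: "(real^2) set \<Rightarrow> ((real^2) set \<Rightarrow> real^2) \<Rightarrow> (real^2) measure" where
  "variation_measure \<Omega> D = measure_of \<Omega> (sets (restrict_space borel \<Omega>))
     (\<lambda>B. SUP P \<in> {P. finite P \<and> disjoint P \<and> P \<subseteq> sets (restrict_space borel \<Omega>) \<and> \<Union>P \<subseteq> B}.
            \<Sum>A\<in>P. ennreal (norm (D A)))"

definition polar_density :: "(real^2) set \<Rightarrow> ((real^2) set \<Rightarrow> real^2) \<Rightarrow> real^2 \<Rightarrow> real^2" where
  "polar_density \<Omega> D = (SOME \<nu>. \<nu> \<in> borel_measurable (variation_measure \<Omega> D) \<and>
     (\<forall>y\<in>\<Omega>. norm (\<nu> y) = 1) \<and>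
     (\<forall>B \<in> sets (variation_measure \<Omega> D). D B = (LINT y:B|variation_measure \<Omega> D. \<nu> y)))"

definition is_BV_derivative :: "(real^2) set \<Rightarrow> (real^2 \<Rightarrow> real) \<Rightarrow> ((real^2) set \<Rightarrow> real^2) \<Rightarrow> bool" where
  "is_BV_derivative \<Omega> f D \<longleftrightarrow> vector_measure \<Omega> D \<and>
     (\<forall>v \<in> test_fields \<Omega>.
        (LINT x|lebesgue_on \<Omega>. f x * divergence v x)
          = - (LINT y|variation_measure \<Omega> D. v y \<bullet> polar_density \<Omega> D y))"

definition BV :: "(real^2) set \<Rightarrow> (real^2 \<Rightarrow> real) set" where
  "BV \<Omega> = {f. integrable (lebesgue_on \<Omega>) f \<and> (\<exists>D. is_BV_derivative \<Omega> f D)}"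

text \<open>The derivative is unique on the Borel subsets of \<open>\<Omega>\<close>, its polar density is unique almost
  everywhere.\<close>

definition BV_derivative :: "(real^2) set \<Rightarrow> (real^2 \<Rightarrow> real) \<Rightarrow> (real^2) set \<Rightarrow> real^2" where
  "BV_derivative \<Omega> f = (SOME D. is_BV_derivative \<Omega> f D)"

definition BV_variation :: "(real^2) set \<Rightarrow> (real^2 \<Rightarrow> real) \<Rightarrow> (real^2) measure" where
  "BV_variation \<Omega> f = variation_measure \<Omega> (BV_derivative \<Omega> f)"

definition BV_direction :: "(real^2) set \<Rightarrow> (real^2 \<Rightarrow> real) \<Rightarrow> real^2 \<Rightarrow> real^2" where
  "BV_direction \<Omega> f = polar_density \<Omega> (BV_derivative \<Omega> f)"

text \<open>Boundary trace: the value approximated by \<open>f\<close> in mean on the parts of small balls inside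
  \<open>\<Omega>\<close>. For \<open>f\<close> of bounded variation it exists at almost every boundary point of a Lipschitz domain.\<close>

definition BV_trace :: "(real^2) set \<Rightarrow> (real^2 \<Rightarrow> real) \<Rightarrow> real^2 \<Rightarrow> real" where
  "BV_trace \<Omega> f y =
     (THE t. ((\<lambda>r. (LINT x:(\<Omega> \<inter> ball y r)|lebesgue. \<bar>f x - t\<bar>) / r\<^sup>2) \<longlongrightarrow> 0) (at_right 0))"


section \<open>Green's functions\<close>

text \<open>\<open>-\<Delta>u = \<delta>\<^sub>x - c\<close> in \<open>\<Omega>\<close> in the sense of distributions.\<close>

definition solves_point_source :: "(real^2) set \<Rightarrow> real^2 \<Rightarrow> real \<Rightarrow> (real^2 \<Rightarrow> real) \<Rightarrow> bool" where
  "solves_point_source \<Omega> x c u \<longleftrightarrow> integrable (lebesgue_on \<Omega>) u \<and>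
     (\<forall>\<phi> \<in> test_functions \<Omega>.
        - (LINT y|lebesgue_on \<Omega>. u y * laplacian \<phi> y) = \<phi> x - c * (LINT y|lebesgue_on \<Omega>. \<phi> y))"

text \<open>Continuity up to the boundary gives the Dirichlet condition its meaning and, by Weyl's lemma,
  makes each \<open>G(\<cdot>;x)\<close> smooth in \<open>\<Omega> - {x}\<close>.\<close>

definition symmetric_green_function :: "(real^2) set \<Rightarrow> real \<Rightarrow> (real^2 \<Rightarrow> real^2 \<Rightarrow> real) \<Rightarrow> bool" where
  "symmetric_green_function \<Omega> c G \<longleftrightarrow>
     (\<forall>x\<in>\<Omega>. \<forall>y\<in>\<Omega>. G x y = G y x) \<and>
     (\<forall>x\<in>\<Omega>. solves_point_source \<Omega> x c (\<lambda>y. G y x) \<and>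
              continuous_on (closure \<Omega> - {x}) (\<lambda>y. G y x))"

text \<open>The normal derivative on the boundary is the limit from inside along the normal.\<close>

definition has_normal_derivative :: "(real^2) set \<Rightarrow> (real^2 \<Rightarrow> real) \<Rightarrow> real^2 \<Rightarrow> real \<Rightarrow> bool" where
  "has_normal_derivative \<Omega> u y l \<longleftrightarrow>
     ((\<lambda>t. grad u (y - t *\<^sub>R outward_normal \<Omega> y) \<bullet> outward_normal \<Omega> y) \<longlongrightarrow> l) (at_right 0)"

definition normal_derivative :: "(real^2) set \<Rightarrow> (real^2 \<Rightarrow> real) \<Rightarrow> real^2 \<Rightarrow> real" where
  "normal_derivative \<Omega> u y = (THE l. has_normal_derivative \<Omega> u y l)"

definition dirichlet_green_function :: "(real^2) set \<Rightarrow> (real^2 \<Rightarrow> real^2 \<Rightarrow> real) \<Rightarrow> bool" where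
  "dirichlet_green_function \<Omega> G \<longleftrightarrow> symmetric_green_function \<Omega> 0 G \<and>
     (\<forall>x\<in>\<Omega>. \<forall>y\<in>frontier \<Omega>. G y x = 0)"

definition neumann_green_function :: "(real^2) set \<Rightarrow> (real^2 \<Rightarrow> real^2 \<Rightarrow> real) \<Rightarrow> bool" where
  "neumann_green_function \<Omega> G \<longleftrightarrow> symmetric_green_function \<Omega> (1 / measure lebesgue \<Omega>) G \<and>
     (\<forall>x\<in>\<Omega>. AE y in surface_measure \<Omega>. has_normal_derivative \<Omega> (\<lambda>y. G y x) y 0)"

text \<open>\<open>\<nabla>G(\<cdot>;y) \<cdot> d\<close> and \<open>\<partial>\<^sub>n G(\<cdot>;y)\<close>: derivatives in \<open>y\<close>, as functions of \<open>x\<close>.\<close>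

definition gradG :: "(real^2 \<Rightarrow> real^2 \<Rightarrow> real) \<Rightarrow> real^2 \<Rightarrow> real^2 \<Rightarrow> real^2 \<Rightarrow> real" where
  "gradG G y d = (\<lambda>x. grad (\<lambda>y. G x y) y \<bullet> d)"

definition normalG :: "(real^2) set \<Rightarrow> (real^2 \<Rightarrow> real^2 \<Rightarrow> real) \<Rightarrow> real^2 \<Rightarrow> real^2 \<Rightarrow> real" where
  "normalG \<Omega> G y = (\<lambda>x. normal_derivative \<Omega> (\<lambda>y. G x y) y)"


section \<open>The operator, the weights and the dual field\<close>

text \<open>\<open>K\<close> acts on functions and depends only on the almost-everywhere class of its argument.
  It is linear from \<open>L\<^sup>2(\<Omega>)\<close> to \<open>L\<^sup>2(\<partial>\<Omega>)\<close>; its argument is not restricted to \<open>L\<^sup>2(\<Omega>)\<close> because it is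
  also applied to \<open>\<nabla>G(\<cdot>;y) \<cdot> d\<close>, whose singularity at \<open>y\<close> is not square integrable.\<close>

definition linear_L2_operator :: "(real^2) set \<Rightarrow> ((real^2 \<Rightarrow> real) \<Rightarrow> real^2 \<Rightarrow> real) \<Rightarrow> bool" where
  "linear_L2_operator \<Omega> K \<longleftrightarrow>
     (\<forall>u v. (AE x in lebesgue_on \<Omega>. u x = v x) \<longrightarrow> (AE z in surface_measure \<Omega>. K u z = K v z)) \<and>
     (\<forall>u \<in> Lp_space (lebesgue_on \<Omega>) 2. K u \<in> Lp_space (surface_measure \<Omega>) 2) \<and>
     (\<forall>u \<in> Lp_space (lebesgue_on \<Omega>) 2. \<forall>v \<in> Lp_space (lebesgue_on \<Omega>) 2. \<forall>a b.
        AE z in surface_measure \<Omega>. K (\<lambda>x. a * u x + b * v x) z = a * K u z + b * K v z)"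

definition pairing :: "(real^2) set \<Rightarrow> (real^2 \<Rightarrow> real) \<Rightarrow> (real^2 \<Rightarrow> real) \<Rightarrow> real" where
  "pairing \<Omega> l g = (LINT z|surface_measure \<Omega>. l z * g z)"

definition w_tilde ::
  "(real^2) set \<Rightarrow> ((real^2 \<Rightarrow> real) \<Rightarrow> real^2 \<Rightarrow> real) \<Rightarrow> (real^2 \<Rightarrow> real^2 \<Rightarrow> real) \<Rightarrow> real \<Rightarrow>
   real^2 \<Rightarrow> real^2 \<Rightarrow> real" where
  "w_tilde \<Omega> K G p y d = enn2real (Lp_norm (surface_measure \<Omega>) (ennreal p) (K (gradG G y d)))"

definition w_boundary ::
  "(real^2) set \<Rightarrow> ((real^2 \<Rightarrow> real) \<Rightarrow> real^2 \<Rightarrow> real) \<Rightarrow> (real^2 \<Rightarrow> real^2 \<Rightarrow> real) \<Rightarrow> real \<Rightarrow>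
   real^2 \<Rightarrow> real" where
  "w_boundary \<Omega> K G p y = enn2real (Lp_norm (surface_measure \<Omega>) (ennreal p) (K (normalG \<Omega> G y)))"

definition z_field ::
  "(real^2) set \<Rightarrow> ((real^2 \<Rightarrow> real) \<Rightarrow> real^2 \<Rightarrow> real) \<Rightarrow> (real^2 \<Rightarrow> real^2 \<Rightarrow> real) \<Rightarrow>
   (real^2 \<Rightarrow> real) \<Rightarrow> real^2 \<Rightarrow> real^2" where
  "z_field \<Omega> K G l y = (\<chi> i. pairing \<Omega> l (K (gradG G y (axis i 1))))"

text \<open>\<open>z\<^sub>\<lambda> \<cdot> n\<close> on the boundary.\<close>

definition z_normal ::
  "(real^2) set \<Rightarrow> ((real^2 \<Rightarrow> real) \<Rightarrow> real^2 \<Rightarrow> real) \<Rightarrow> (real^2 \<Rightarrow> real^2 \<Rightarrow> real) \<Rightarrow>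
   (real^2 \<Rightarrow> real) \<Rightarrow> real^2 \<Rightarrow> real" where
  "z_normal \<Omega> K G l y = pairing \<Omega> l (K (normalG \<Omega> G y))"

definition objective ::
  "(real^2) set \<Rightarrow> ((real^2 \<Rightarrow> real) \<Rightarrow> real^2 \<Rightarrow> real) \<Rightarrow> (real^2 \<Rightarrow> real^2 \<Rightarrow> real) \<Rightarrow> real \<Rightarrow> real \<Rightarrow>
   (real^2 \<Rightarrow> real) \<Rightarrow> ennreal" where
  "objective \<Omega> K G p \<beta> f =
     (\<integral>\<^sup>+ y. ennreal (w_tilde \<Omega> K G p y (BV_direction \<Omega> f y)) \<partial>BV_variation \<Omega> f)
     + ennreal \<beta> * (\<integral>\<^sup>+ y. ennreal (w_boundary \<Omega> K G p y * \<bar>BV_trace \<Omega> f y\<bar>) \<partial>surface_measure \<Omega>)"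


section \<open>Standing conventions\<close>

text \<open>Measurability of an \<open>L\<^sup>p\<close>-valued map \<open>y \<mapsto> k y\<close>, independently of representatives:
  as \<open>L\<^sup>p\<close> is separable for \<open>p < \<infinity>\<close>, its Borel sets are generated by balls.\<close>

definition Lp_measurable_map ::
  "'a measure \<Rightarrow> 'b measure \<Rightarrow> real \<Rightarrow> ('a \<Rightarrow> 'b \<Rightarrow> real) \<Rightarrow> bool" where
  "Lp_measurable_map N M p k \<longleftrightarrow>
     (\<forall>g \<in> Lp_space M (ennreal p). (\<lambda>y. Lp_norm M (ennreal p) (\<lambda>z. k y z - g z)) \<in> borel_measurable N)"

definition gradient_kernel_convention ::
  "(real^2) set \<Rightarrow> ((real^2 \<Rightarrow> real) \<Rightarrow> real^2 \<Rightarrow> real) \<Rightarrow> (real^2 \<Rightarrow> real^2 \<Rightarrow> real) \<Rightarrow> real \<Rightarrow> bool" where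
  "gradient_kernel_convention \<Omega> K G p \<longleftrightarrow>
     (\<forall>y\<in>\<Omega>. \<forall>d. K (gradG G y d) \<in> Lp_space (surface_measure \<Omega>) (ennreal p)) \<and>
     (\<forall>y\<in>\<Omega>. \<forall>d e a b. AE z in surface_measure \<Omega>.
        K (gradG G y (a *\<^sub>R d + b *\<^sub>R e)) z = a * K (gradG G y d) z + b * K (gradG G y e) z) \<and>
     (\<forall>d. Lp_measurable_map (restrict_space borel \<Omega>) (surface_measure \<Omega>) p (\<lambda>y. K (gradG G y d)))"

definition normal_kernel_convention ::
  "(real^2) set \<Rightarrow> ((real^2 \<Rightarrow> real) \<Rightarrow> real^2 \<Rightarrow> real) \<Rightarrow> (real^2 \<Rightarrow> real^2 \<Rightarrow> real) \<Rightarrow> real \<Rightarrow> bool" where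
  "normal_kernel_convention \<Omega> K G p \<longleftrightarrow>
     (AE y in surface_measure \<Omega>. K (normalG \<Omega> G y) \<in> Lp_space (surface_measure \<Omega>) (ennreal p)) \<and>
     Lp_measurable_map (surface_measure \<Omega>) (surface_measure \<Omega>) p (\<lambda>y. K (normalG \<Omega> G y))"

definition dirichlet_representation ::
  "(real^2) set \<Rightarrow> (real^2 \<Rightarrow> real^2 \<Rightarrow> real) \<Rightarrow> (real^2 \<Rightarrow> real) \<Rightarrow> real^2 \<Rightarrow> real" where
  "dirichlet_representation \<Omega> G f x =
     (LINT y|BV_variation \<Omega> f. gradG G y (BV_direction \<Omega> f y) x)
     - (LINT y|surface_measure \<Omega>. normalG \<Omega> G y x * BV_trace \<Omega> f y)"

definition neumann_representation ::
  "(real^2) set \<Rightarrow> (real^2 \<Rightarrow> real^2 \<Rightarrow> real) \<Rightarrow> (real^2 \<Rightarrow> real) \<Rightarrow> real^2 \<Rightarrow> real" where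
  "neumann_representation \<Omega> G f x =
     (LINT y|BV_variation \<Omega> f. gradG G y (BV_direction \<Omega> f y) x)
     + 1 / measure lebesgue \<Omega> * (LINT y|lebesgue_on \<Omega>. f y)"

text \<open>In both settings the last two conjuncts are the representation formula and the interchange
  of \<open>K\<close> and of the pairing with the integrals in it; the convergence of the integrals is part
  of the assertion. The interchange is stated for the whole right-hand side because its two terms
  need not be separately square integrable.\<close>

definition dirichlet_setting ::
  "(real^2) set \<Rightarrow> ((real^2 \<Rightarrow> real) \<Rightarrow> real^2 \<Rightarrow> real) \<Rightarrow> (real^2 \<Rightarrow> real^2 \<Rightarrow> real) \<Rightarrow>
   real \<Rightarrow> ennreal \<Rightarrow> bool" where
  "dirichlet_setting \<Omega> K G p q \<longleftrightarrow>
     dirichlet_green_function \<Omega> G \<and>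
     gradient_kernel_convention \<Omega> K G p \<and>
     normal_kernel_convention \<Omega> K G p \<and>
     (\<forall>f \<in> BV \<Omega>. AE x in lebesgue_on \<Omega>.
        integrable (BV_variation \<Omega> f) (\<lambda>y. gradG G y (BV_direction \<Omega> f y) x) \<and>
        integrable (surface_measure \<Omega>) (\<lambda>y. normalG \<Omega> G y x * BV_trace \<Omega> f y) \<and>
        f x = dirichlet_representation \<Omega> G f x) \<and>
     (\<forall>f \<in> BV \<Omega>. \<forall>l \<in> Lp_space (surface_measure \<Omega>) q.
        integrable (surface_measure \<Omega>) (\<lambda>z. l z * K (dirichlet_representation \<Omega> G f) z) \<and>
        integrable (BV_variation \<Omega> f) (\<lambda>y. pairing \<Omega> l (K (gradG G y (BV_direction \<Omega> f y)))) \<and>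
        integrable (surface_measure \<Omega>) (\<lambda>y. pairing \<Omega> l (K (normalG \<Omega> G y)) * BV_trace \<Omega> f y) \<and>
        pairing \<Omega> l (K (dirichlet_representation \<Omega> G f)) =
          (LINT y|BV_variation \<Omega> f. pairing \<Omega> l (K (gradG G y (BV_direction \<Omega> f y))))
          - (LINT y|surface_measure \<Omega>. pairing \<Omega> l (K (normalG \<Omega> G y)) * BV_trace \<Omega> f y))"

definition neumann_setting ::
  "(real^2) set \<Rightarrow> ((real^2 \<Rightarrow> real) \<Rightarrow> real^2 \<Rightarrow> real) \<Rightarrow> (real^2 \<Rightarrow> real^2 \<Rightarrow> real) \<Rightarrow>
   real \<Rightarrow> ennreal \<Rightarrow> bool" where
  "neumann_setting \<Omega> K G p q \<longleftrightarrow>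
     neumann_green_function \<Omega> G \<and>
     (AE z in surface_measure \<Omega>. K (\<lambda>_. 1) z = 0) \<and>
     gradient_kernel_convention \<Omega> K G p \<and>
     (\<forall>f \<in> BV \<Omega>. AE x in lebesgue_on \<Omega>.
        integrable (BV_variation \<Omega> f) (\<lambda>y. gradG G y (BV_direction \<Omega> f y) x) \<and>
        f x = neumann_representation \<Omega> G f x) \<and>
     (\<forall>f \<in> BV \<Omega>. \<forall>l \<in> Lp_space (surface_measure \<Omega>) q.
        integrable (surface_measure \<Omega>) (\<lambda>z. l z * K (neumann_representation \<Omega> G f) z) \<and>
        integrable (BV_variation \<Omega> f) (\<lambda>y. pairing \<Omega> l (K (gradG G y (BV_direction \<Omega> f y)))) \<and>
        pairing \<Omega> l (K (neumann_representation \<Omega> G f)) =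
          (LINT y|BV_variation \<Omega> f. pairing \<Omega> l (K (gradG G y (BV_direction \<Omega> f y))))
          + 1 / measure lebesgue \<Omega> * (LINT y|lebesgue_on \<Omega>. f y) * pairing \<Omega> l (K (\<lambda>_. 1)))"

end

theory Submission
  imports Defs
begin

text \<open>The hypotheses make \<open>\<lambda>\<close> a dual certificate, and the proof is weak duality. For \<open>f\<close> of bounded
  variation put
  \<open>B(f) = \<integral> \<langle>\<lambda>, K(\<nabla>G(\<cdot>;y) \<cdot> \<nu>\<^sub>f)\<rangle> d\<bar>Df\<bar> - \<integral> (z\<^sub>\<lambda> \<cdot> n) f ds\<close>, where the boundary integral is
  absent in the Neumann setting. Interchanging \<open>K\<close> and the pairing with the integrals in the
  representation formula gives \<open>B(f) = \<langle>\<lambda>, Kf\<rangle>\<close> (the mean value term of the Neumann formula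
  contributes nothing because \<open>K\<close> annihilates constants). Hence \<open>B\<close> is constant on the feasible
  set.

  Hoelder's inequality and \<open>\<parallel>\<lambda>\<parallel>\<^sub>q \<le> 1\<close> bound the first integrand by \<open>w(y, \<nu>\<^sub>f)\<close>, and (iii)
  bounds the second by \<open>\<beta> w\<^sub>\<partial> \<bar>f\<bar>\<close>, so that \<open>B(f)\<close> never exceeds the objective at \<open>f\<close>. For the
  candidate minimizer, (ii) and (iv) say that both bounds hold with equality. The objective at the
  candidate is therefore \<open>B\<close> of the candidate, which is \<open>B(f)\<close>, which is at most the objective
  at \<open>f\<close>.

  Objectives are extended nonnegative numbers whereas \<open>B\<close> is real; the comparison of the two is
  the content of \<open>interior_weak_duality\<close>, \<open>boundary_weak_duality\<close> and their two equality
  counterparts.\<close>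

section \<open>Hoelder's inequality\<close>

lemma enn2real_Lp_norm:
  assumes "u \<in> Lp_space M r"
  shows "ennreal (enn2real (Lp_norm M r u)) = Lp_norm M r u"
  using assms by (simp add: Lp_space_def less_top)

text \<open>Removes the case distinction in the norm: on the Lebesgue space the integral is finite, so
  it can be recovered from the norm.\<close>

lemma nn_integral_powr_eq_Lp_norm:
  assumes "0 < r" and u: "u \<in> Lp_space M (ennreal r)"
  shows "(\<integral>\<^sup>+ x. ennreal (\<bar>u x\<bar> powr r) \<partial>M) = ennreal (enn2real (Lp_norm M (ennreal r) u) powr r)"
proof -
  let ?I = "\<integral>\<^sup>+ x. ennreal (\<bar>u x\<bar> powr r) \<partial>M"
  have norm: "Lp_norm M (ennreal r) u =
      (if ?I = \<infinity> then \<infinity> else ennreal (enn2real ?I powr (1 / r)))"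
    using assms(1) by (simp add: Lp_norm_def Let_def)
  have fin: "?I < \<infinity>"
    using u norm by (auto simp: Lp_space_def less_top split: if_splits)
  then have "enn2real (Lp_norm M (ennreal r) u) = enn2real ?I powr (1 / r)"
    using norm by simp
  then have "enn2real (Lp_norm M (ennreal r) u) powr r = enn2real ?I"
    using assms(1) by (simp add: powr_powr)
  then show ?thesis
    using fin by (simp add: less_top)
qed

lemma Holder_nn_integral_real:
  fixes p q :: real
  assumes "1 < p" "1 < q" "1 / q + 1 / p = 1"
    and l: "l \<in> Lp_space M (ennreal q)" and k: "k \<in> Lp_space M (ennreal p)"
  shows "(\<integral>\<^sup>+ x. ennreal \<bar>l x * k x\<bar> \<partial>M) \<le> Lp_norm M (ennreal q) l * Lp_norm M (ennreal p) k"
proof -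
  define L where "L = enn2real (Lp_norm M (ennreal q) l)"
  define N where "N = enn2real (Lp_norm M (ennreal p) k)"
  have [measurable]: "l \<in> borel_measurable M" "k \<in> borel_measurable M"
    using l k by (auto simp: Lp_space_def)
  have IL: "(\<integral>\<^sup>+ x. ennreal (\<bar>l x\<bar> powr q) \<partial>M) = ennreal (L powr q)"
    unfolding L_def using assms by (intro nn_integral_powr_eq_Lp_norm) auto
  have IN: "(\<integral>\<^sup>+ x. ennreal (\<bar>k x\<bar> powr p) \<partial>M) = ennreal (N powr p)"
    unfolding N_def using assms by (intro nn_integral_powr_eq_Lp_norm) auto
  have LN: "Lp_norm M (ennreal q) l * Lp_norm M (ennreal p) k = ennreal (L * N)"
    using enn2real_Lp_norm[OF l] enn2real_Lp_norm[OF k]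
    by (simp add: L_def N_def ennreal_mult)
  have "0 \<le> L" "0 \<le> N" by (auto simp: L_def N_def)
  then consider "L = 0" | "N = 0" | "0 < L" "0 < N" by linarith
  then show ?thesis
  proof cases
    case 1
    then have "AE x in M. l x = 0"
      using IL by (auto simp: nn_integral_0_iff_AE)
    then have "(\<integral>\<^sup>+ x. ennreal \<bar>l x * k x\<bar> \<partial>M) = 0"
      by (subst nn_integral_0_iff_AE) auto
    then show ?thesis by simp
  next
    case 2
    then have "AE x in M. k x = 0"
      using IN by (auto simp: nn_integral_0_iff_AE)
    then have "(\<integral>\<^sup>+ x. ennreal \<bar>l x * k x\<bar> \<partial>M) = 0"
      by (subst nn_integral_0_iff_AE) auto
    then show ?thesis by simp
  next
    case 3
    define a where "a = L * N * (1 / q) / L powr q"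
    define b where "b = L * N * (1 / p) / N powr p"
    have ab: "0 \<le> a" "0 \<le> b" using 3 assms by (auto simp: a_def b_def)
    \<comment> \<open>Young's inequality for the normalised functions \<open>l / L\<close> and \<open>k / N\<close>.\<close>
    have Young: "\<bar>l x * k x\<bar> \<le> a * \<bar>l x\<bar> powr q + b * \<bar>k x\<bar> powr p" for x
    proof -
      have "\<bar>l x\<bar> / L * (\<bar>k x\<bar> / N) \<le> (\<bar>l x\<bar> / L) powr q / q + (\<bar>k x\<bar> / N) powr p / p"
        using 3 assms by (intro Youngs_inequality) auto
      then have "L * N * (\<bar>l x\<bar> / L * (\<bar>k x\<bar> / N))
          \<le> L * N * ((\<bar>l x\<bar> / L) powr q / q + (\<bar>k x\<bar> / N) powr p / p)"
        using 3 by (intro mult_left_mono) auto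
      then show ?thesis
        using 3 by (simp add: a_def b_def powr_divide abs_mult algebra_simps)
    qed
    have "(\<integral>\<^sup>+ x. ennreal \<bar>l x * k x\<bar> \<partial>M)
        \<le> (\<integral>\<^sup>+ x. ennreal a * ennreal (\<bar>l x\<bar> powr q) + ennreal b * ennreal (\<bar>k x\<bar> powr p) \<partial>M)"
      using Young ab
      by (intro nn_integral_mono) (simp add: ennreal_plus[symmetric] ennreal_mult[symmetric] del: ennreal_plus)
    also have "\<dots> = ennreal a * ennreal (L powr q) + ennreal b * ennreal (N powr p)"
      by (simp add: nn_integral_add nn_integral_cmult IL IN)
    also have "\<dots> = ennreal (a * L powr q + b * N powr p)"
      using ab by (simp add: ennreal_mult)
    also have "a * L powr q + b * N powr p = L * N * (1 / q + 1 / p)"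
      using 3 by (simp add: a_def b_def algebra_simps)
    finally show ?thesis using assms(3) LN by simp
  qed
qed

lemma Holder_nn_integral:
  assumes "1 \<le> p" "inverse (ennreal p) + inverse q = 1"
    and l: "l \<in> Lp_space M q" and k: "k \<in> Lp_space M (ennreal p)"
  shows "(\<integral>\<^sup>+ x. ennreal \<bar>l x * k x\<bar> \<partial>M) \<le> Lp_norm M q l * Lp_norm M (ennreal p) k"
proof (cases "p = 1")
  case True
  have "q = \<infinity>"
    using assms(2) True by (simp add: ennreal_add_left_cancel[of 1 _ 0, simplified])
  have [measurable]: "l \<in> borel_measurable M" "k \<in> borel_measurable M"
    using l k by (auto simp: Lp_space_def)
  have "AE x in M. ennreal \<bar>l x\<bar> \<le> Lp_norm M q l"
    using esssup_AE[where M = M and f = "\<lambda>x. ennreal \<bar>l x\<bar>"] \<open>q = \<infinity>\<close> by (simp add: Lp_norm_def)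
  then have "(\<integral>\<^sup>+ x. ennreal \<bar>l x * k x\<bar> \<partial>M) \<le> (\<integral>\<^sup>+ x. Lp_norm M q l * ennreal \<bar>k x\<bar> \<partial>M)"
    by (intro nn_integral_mono_AE) (auto simp: abs_mult ennreal_mult mult_right_mono)
  also have "\<dots> = Lp_norm M q l * (\<integral>\<^sup>+ x. ennreal \<bar>k x\<bar> \<partial>M)"
    by (simp add: nn_integral_cmult)
  also have "(\<integral>\<^sup>+ x. ennreal \<bar>k x\<bar> \<partial>M) = Lp_norm M (ennreal p) k"
    using nn_integral_powr_eq_Lp_norm[of p k M] k True enn2real_Lp_norm[OF k] by simp
  finally show ?thesis .
next
  case False
  then have "1 < p" using assms(1) by simp
  have "q \<noteq> \<infinity>"
    using assms(2) \<open>1 < p\<close> by (auto simp: inverse_ennreal ennreal_eq_1)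
  then obtain r where r: "0 \<le> r" "q = ennreal r" by (cases q) auto
  have "r \<noteq> 0" using assms(2) r by auto
  have "1 / p + 1 / r = 1"
  proof -
    have "ennreal (1 / p + 1 / r) = 1"
      using assms(2) r \<open>r \<noteq> 0\<close> \<open>1 < p\<close> by (simp add: inverse_ennreal inverse_eq_divide)
    then show ?thesis by (simp only: ennreal_eq_1)
  qed
  moreover have "1 < r"
  proof -
    have "1 / r < 1" using calculation \<open>1 < p\<close> by (smt (verit) divide_pos_pos)
    then show ?thesis using r(1) \<open>r \<noteq> 0\<close> by (simp add: divide_simps split: if_splits)
  qed
  ultimately show ?thesis
    using Holder_nn_integral_real[of p r l M k] \<open>1 < p\<close> l k r by simp
qed

lemma Holder_integrable:
  assumes "1 \<le> p" "inverse (ennreal p) + inverse q = 1"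
    and l: "l \<in> Lp_space M q" and k: "k \<in> Lp_space M (ennreal p)"
  shows "integrable M (\<lambda>x. l x * k x)"
proof (rule integrableI_bounded)
  show "(\<lambda>x. l x * k x) \<in> borel_measurable M"
    using l k by (auto simp: Lp_space_def)
  have "Lp_norm M q l * Lp_norm M (ennreal p) k < \<infinity>"
    using l k by (simp add: Lp_space_def ennreal_mult_less_top)
  then show "(\<integral>\<^sup>+ x. ennreal (norm (l x * k x)) \<partial>M) < \<infinity>"
    using Holder_nn_integral[OF assms] by (simp add: le_less_trans)
qed

lemma pairing_le_Lp_norm:
  assumes pq: "1 \<le> p" "inverse (ennreal p) + inverse q = 1"
    and l: "l \<in> Lp_space (surface_measure \<Omega>) q" "Lp_norm (surface_measure \<Omega>) q l \<le> 1"
    and k: "k \<in> Lp_space (surface_measure \<Omega>) (ennreal p)"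
  shows "pairing \<Omega> l k \<le> enn2real (Lp_norm (surface_measure \<Omega>) (ennreal p) k)"
proof -
  let ?M = "surface_measure \<Omega>"
  have "ennreal \<bar>pairing \<Omega> l k\<bar> \<le> (\<integral>\<^sup>+ x. ennreal \<bar>l x * k x\<bar> \<partial>?M)"
    using integral_norm_bound_ennreal[OF Holder_integrable[OF pq l(1) k]] by (simp add: pairing_def)
  also have "\<dots> \<le> Lp_norm ?M q l * Lp_norm ?M (ennreal p) k"
    by (rule Holder_nn_integral[OF pq l(1) k])
  also have "\<dots> \<le> 1 * Lp_norm ?M (ennreal p) k"
    by (intro mult_right_mono l(2)) simp
  finally have "\<bar>pairing \<Omega> l k\<bar> \<le> enn2real (Lp_norm ?M (ennreal p) k)"
    using enn2real_Lp_norm[OF k] by (metis enn2real_nonneg ennreal_le_iff mult_1)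
  then show ?thesis by simp
qed


section \<open>The dual field\<close>

lemma pairing_linear:
  assumes pq: "1 \<le> p" "inverse (ennreal p) + inverse q = 1"
    and l: "l \<in> Lp_space (surface_measure \<Omega>) q"
    and "g \<in> Lp_space (surface_measure \<Omega>) (ennreal p)"
      "h \<in> Lp_space (surface_measure \<Omega>) (ennreal p)" "k \<in> Lp_space (surface_measure \<Omega>) (ennreal p)"
    and k: "AE z in surface_measure \<Omega>. k z = a * g z + b * h z"
  shows "pairing \<Omega> l k = a * pairing \<Omega> l g + b * pairing \<Omega> l h"
proof -
  note int = Holder_integrable[OF pq l]
  have "pairing \<Omega> l k = (LINT z|surface_measure \<Omega>. a * (l z * g z) + b * (l z * h z))"
    unfolding pairing_def
    using k int[OF assms(4)] int[OF assms(5)] int[OF assms(6)]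
    by (intro integral_cong_AE) (auto simp: algebra_simps)
  then show ?thesis
    using int[OF assms(4)] int[OF assms(5)] by (simp add: pairing_def)
qed

text \<open>The field is defined by its two components; linearity of the kernel in the direction turns
  the inner product with a direction into a single pairing.\<close>

lemma z_field_inner:
  assumes pq: "1 \<le> p" "inverse (ennreal p) + inverse q = 1"
    and l: "l \<in> Lp_space (surface_measure \<Omega>) q"
    and K: "gradient_kernel_convention \<Omega> K G p" and y: "y \<in> \<Omega>"
  shows "z_field \<Omega> K G l y \<bullet> d = pairing \<Omega> l (K (gradG G y d))"
proof -
  have Lp: "K (gradG G y e) \<in> Lp_space (surface_measure \<Omega>) (ennreal p)" for e
    using K y by (auto simp: gradient_kernel_convention_def)
  have d: "d = d $ 1 *\<^sub>R axis 1 1 + d $ 2 *\<^sub>R axis 2 1"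
    by (simp add: vec_eq_iff axis_def forall_2)
  have "AE z in surface_measure \<Omega>. K (gradG G y d) z =
      d $ 1 * K (gradG G y (axis 1 1)) z + d $ 2 * K (gradG G y (axis 2 1)) z"
  proof -
    have "AE z in surface_measure \<Omega>. K (gradG G y (d $ 1 *\<^sub>R axis 1 1 + d $ 2 *\<^sub>R axis 2 1)) z =
        d $ 1 * K (gradG G y (axis 1 1)) z + d $ 2 * K (gradG G y (axis 2 1)) z"
      using K y by (simp add: gradient_kernel_convention_def)
    then show ?thesis by (simp only: d[symmetric])
  qed
  then have "pairing \<Omega> l (K (gradG G y d)) = d $ 1 * pairing \<Omega> l (K (gradG G y (axis 1 1)))
      + d $ 2 * pairing \<Omega> l (K (gradG G y (axis 2 1)))"
    by (intro pairing_linear[OF pq l Lp Lp Lp])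
  then show ?thesis
    by (simp add: inner_vec_def sum_2 z_field_def)
qed


section \<open>Weak duality in the interior and on the boundary\<close>

lemma ennreal_integral_le_nn_integral:
  assumes "integrable M f"
  shows "ennreal (integral\<^sup>L M f) \<le> (\<integral>\<^sup>+ x. ennreal (f x) \<partial>M)"
proof -
  have "(\<integral>\<^sup>+ x. ennreal (f x) \<partial>M) < \<infinity>"
    using assms by (simp add: real_integrable_def less_top)
  moreover have "integral\<^sup>L M f \<le> enn2real (\<integral>\<^sup>+ x. ennreal (f x) \<partial>M)"
    using real_lebesgue_integral_def[OF assms] by simp
  ultimately show ?thesis
    by (metis enn2real_nonneg ennreal_enn2real ennreal_leI infinity_ennreal_def)
qed

lemma AE_BV_variation_in_domain: "AE y in BV_variation \<Omega> f. y \<in> \<Omega>"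
  using AE_space[of "BV_variation \<Omega> f"]
  by (simp add: BV_variation_def variation_measure_def space_measure_of_conv)

text \<open>A competitor's pairing may be negative, so its integral is compared with an extended
  nonnegative integral by discarding the negative part.\<close>

lemma interior_weak_duality:
  assumes pq: "1 \<le> p" "inverse (ennreal p) + inverse q = 1"
    and l: "l \<in> Lp_space (surface_measure \<Omega>) q" "Lp_norm (surface_measure \<Omega>) q l \<le> 1"
    and K: "gradient_kernel_convention \<Omega> K G p"
    and int: "integrable (BV_variation \<Omega> f) (\<lambda>y. pairing \<Omega> l (K (gradG G y (BV_direction \<Omega> f y))))"
  shows "ennreal (LINT y|BV_variation \<Omega> f. pairing \<Omega> l (K (gradG G y (BV_direction \<Omega> f y))))
    \<le> (\<integral>\<^sup>+ y. ennreal (w_tilde \<Omega> K G p y (BV_direction \<Omega> f y)) \<partial>BV_variation \<Omega> f)"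
proof -
  have "AE y in BV_variation \<Omega> f. pairing \<Omega> l (K (gradG G y (BV_direction \<Omega> f y)))
      \<le> w_tilde \<Omega> K G p y (BV_direction \<Omega> f y)"
    using AE_BV_variation_in_domain
  proof eventually_elim
    case (elim y)
    then have "K (gradG G y (BV_direction \<Omega> f y)) \<in> Lp_space (surface_measure \<Omega>) (ennreal p)"
      using K by (auto simp: gradient_kernel_convention_def)
    then show ?case
      unfolding w_tilde_def by (rule pairing_le_Lp_norm[OF pq l])
  qed
  then have "(\<integral>\<^sup>+ y. ennreal (pairing \<Omega> l (K (gradG G y (BV_direction \<Omega> f y)))) \<partial>BV_variation \<Omega> f)
      \<le> (\<integral>\<^sup>+ y. ennreal (w_tilde \<Omega> K G p y (BV_direction \<Omega> f y)) \<partial>BV_variation \<Omega> f)"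
    by (intro nn_integral_mono_AE) (auto intro: ennreal_leI)
  with ennreal_integral_le_nn_integral[OF int] show ?thesis by (rule order_trans)
qed

lemma interior_duality_attained:
  assumes pq: "1 \<le> p" "inverse (ennreal p) + inverse q = 1"
    and l: "l \<in> Lp_space (surface_measure \<Omega>) q"
    and K: "gradient_kernel_convention \<Omega> K G p"
    and int: "integrable (BV_variation \<Omega> f) (\<lambda>y. pairing \<Omega> l (K (gradG G y (BV_direction \<Omega> f y))))"
    and z: "AE y in BV_variation \<Omega> f.
      z_field \<Omega> K G l y \<bullet> BV_direction \<Omega> f y = w_tilde \<Omega> K G p y (BV_direction \<Omega> f y)"
  shows "(\<integral>\<^sup>+ y. ennreal (w_tilde \<Omega> K G p y (BV_direction \<Omega> f y)) \<partial>BV_variation \<Omega> f)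
      = ennreal (LINT y|BV_variation \<Omega> f. pairing \<Omega> l (K (gradG G y (BV_direction \<Omega> f y))))"
    and "0 \<le> (LINT y|BV_variation \<Omega> f. pairing \<Omega> l (K (gradG G y (BV_direction \<Omega> f y))))"
proof -
  have eq: "AE y in BV_variation \<Omega> f. w_tilde \<Omega> K G p y (BV_direction \<Omega> f y)
      = pairing \<Omega> l (K (gradG G y (BV_direction \<Omega> f y)))"
    using z AE_BV_variation_in_domain
    by eventually_elim (simp add: z_field_inner[OF pq l K])
  then have nonneg: "AE y in BV_variation \<Omega> f. 0 \<le> pairing \<Omega> l (K (gradG G y (BV_direction \<Omega> f y)))"
    by eventually_elim (metis enn2real_nonneg w_tilde_def)
  have "(\<integral>\<^sup>+ y. ennreal (w_tilde \<Omega> K G p y (BV_direction \<Omega> f y)) \<partial>BV_variation \<Omega> f)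
      = (\<integral>\<^sup>+ y. ennreal (pairing \<Omega> l (K (gradG G y (BV_direction \<Omega> f y)))) \<partial>BV_variation \<Omega> f)"
    using eq by (intro nn_integral_cong_AE) auto
  also have "\<dots> = ennreal (LINT y|BV_variation \<Omega> f. pairing \<Omega> l (K (gradG G y (BV_direction \<Omega> f y))))"
    by (rule nn_integral_eq_integral[OF int nonneg])
  finally show "(\<integral>\<^sup>+ y. ennreal (w_tilde \<Omega> K G p y (BV_direction \<Omega> f y)) \<partial>BV_variation \<Omega> f)
      = ennreal (LINT y|BV_variation \<Omega> f. pairing \<Omega> l (K (gradG G y (BV_direction \<Omega> f y))))" .
  show "0 \<le> (LINT y|BV_variation \<Omega> f. pairing \<Omega> l (K (gradG G y (BV_direction \<Omega> f y))))"
    by (rule integral_nonneg_AE[OF nonneg])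
qed

text \<open>In the objective the factor \<open>\<beta>\<close> stands in front of the boundary integral, and the trace
  is not known to be measurable on its own. The factor is therefore moved across the integral of
  the product of \<open>z\<^sub>\<lambda> \<cdot> n\<close> with the trace, which is integrable, and only then is that product
  compared with the weighted trace.\<close>

lemma boundary_weak_duality:
  fixes s w t :: "'a \<Rightarrow> real"
  assumes "0 \<le> \<beta>" and int: "integrable M (\<lambda>x. s x * t x)"
    and bound: "AE x in M. \<bar>s x\<bar> \<le> \<beta> * w x"
  shows "ennreal (- (LINT x|M. s x * t x)) \<le> ennreal \<beta> * (\<integral>\<^sup>+ x. ennreal (w x * \<bar>t x\<bar>) \<partial>M)"
proof (cases "\<beta> = 0")
  case True
  have "AE x in M. s x * t x = 0" using bound by eventually_elim (simp add: True)
  then show ?thesis by (simp add: integral_eq_zero_AE)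
next
  case False
  then have "0 < \<beta>" using assms(1) by simp
  have "ennreal (- (LINT x|M. s x * t x)) \<le> (\<integral>\<^sup>+ x. ennreal (- (s x * t x)) \<partial>M)"
    using ennreal_integral_le_nn_integral[of M "\<lambda>x. - (s x * t x)"] int by simp
  also have "\<dots> = (\<integral>\<^sup>+ x. ennreal \<beta> * ennreal (- (s x * t x) / \<beta>) \<partial>M)"
    using \<open>0 < \<beta>\<close> by (simp flip: ennreal_mult')
  also have "\<dots> = ennreal \<beta> * (\<integral>\<^sup>+ x. ennreal (- (s x * t x) / \<beta>) \<partial>M)"
    by (intro nn_integral_cmult measurable_compose[OF _ measurable_ennreal]
        borel_measurable_divide borel_measurable_uminus borel_measurable_integrable[OF int]) simp
  also have "(\<integral>\<^sup>+ x. ennreal (- (s x * t x) / \<beta>) \<partial>M) \<le> (\<integral>\<^sup>+ x. ennreal (w x * \<bar>t x\<bar>) \<partial>M)"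
  proof (intro nn_integral_mono_AE)
    show "AE x in M. ennreal (- (s x * t x) / \<beta>) \<le> ennreal (w x * \<bar>t x\<bar>)"
      using bound
    proof eventually_elim
      case (elim x)
      have "- (s x * t x) \<le> \<bar>s x\<bar> * \<bar>t x\<bar>" by (metis abs_ge_minus_self abs_mult)
      also have "\<dots> \<le> \<beta> * w x * \<bar>t x\<bar>" by (intro mult_right_mono elim) simp
      finally show ?case
        using \<open>0 < \<beta>\<close> by (intro ennreal_leI, subst pos_divide_le_eq) (simp_all add: mult_ac)
    qed
  qed
  finally show ?thesis by (simp add: mult_left_mono)
qed

lemma boundary_duality_attained:
  fixes s w t :: "'a \<Rightarrow> real"
  assumes "0 \<le> \<beta>" and "\<And>x. 0 \<le> w x" and int: "integrable M (\<lambda>x. s x * t x)"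
    and eq: "AE x in M. s x * t x = - (\<beta> * w x * \<bar>t x\<bar>)"
  shows "ennreal \<beta> * (\<integral>\<^sup>+ x. ennreal (w x * \<bar>t x\<bar>) \<partial>M) = ennreal (- (LINT x|M. s x * t x))"
    and "(LINT x|M. s x * t x) \<le> 0"
proof -
  have nonneg: "AE x in M. 0 \<le> - (s x * t x)"
    using eq by eventually_elim (simp add: assms(1,2))
  have "0 \<le> (LINT x|M. - (s x * t x))" by (rule integral_nonneg_AE[OF nonneg])
  then show "(LINT x|M. s x * t x) \<le> 0" by simp
  show "ennreal \<beta> * (\<integral>\<^sup>+ x. ennreal (w x * \<bar>t x\<bar>) \<partial>M) = ennreal (- (LINT x|M. s x * t x))"
  proof (cases "\<beta> = 0")
    case True
    have "AE x in M. s x * t x = 0" using eq by eventually_elim (simp add: True)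
    then show ?thesis using True by (simp add: integral_eq_zero_AE)
  next
    case False
    then have "0 < \<beta>" using assms(1) by simp
    have "(\<integral>\<^sup>+ x. ennreal (w x * \<bar>t x\<bar>) \<partial>M) = (\<integral>\<^sup>+ x. ennreal (- (s x * t x) / \<beta>) \<partial>M)"
      using eq \<open>0 < \<beta>\<close> by (intro nn_integral_cong_AE) auto
    then have "ennreal \<beta> * (\<integral>\<^sup>+ x. ennreal (w x * \<bar>t x\<bar>) \<partial>M)
        = ennreal \<beta> * (\<integral>\<^sup>+ x. ennreal (- (s x * t x) / \<beta>) \<partial>M)" by simp
    also have "\<dots> = (\<integral>\<^sup>+ x. ennreal \<beta> * ennreal (- (s x * t x) / \<beta>) \<partial>M)"
      by (intro nn_integral_cmult[symmetric] measurable_compose[OF _ measurable_ennreal]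
          borel_measurable_divide borel_measurable_uminus borel_measurable_integrable[OF int]) simp
    also have "\<dots> = (\<integral>\<^sup>+ x. ennreal (- (s x * t x)) \<partial>M)"
      using \<open>0 < \<beta>\<close> by (simp flip: ennreal_mult')
    also have "\<dots> = ennreal (LINT x|M. - (s x * t x))"
      using int nonneg by (intro nn_integral_eq_integral) auto
    finally show ?thesis by simp
  qed
qed


section \<open>The dual value on the feasible set\<close>

text \<open>The pairing is applied to \<open>K\<close> of the representation formula rather than to \<open>K\<close> of the
  function itself, since measurability is known for the former.\<close>

lemma pairing_representation_eq:
  assumes K: "linear_L2_operator \<Omega> K"
    and rep: "AE x in lebesgue_on \<Omega>. f x = rf x" "AE x in lebesgue_on \<Omega>. g x = rg x"
    and int: "integrable (surface_measure \<Omega>) (\<lambda>z. l z * K rf z)"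
      "integrable (surface_measure \<Omega>) (\<lambda>z. l z * K rg z)"
    and eq: "AE z in surface_measure \<Omega>. K f z = K g z"
  shows "pairing \<Omega> l (K rf) = pairing \<Omega> l (K rg)"
proof -
  have "AE z in surface_measure \<Omega>. K f z = K rf z" "AE z in surface_measure \<Omega>. K g z = K rg z"
    using K rep unfolding linear_L2_operator_def by blast+
  then have "AE z in surface_measure \<Omega>. l z * K rf z = l z * K rg z"
    using eq by eventually_elim simp
  then show ?thesis
    unfolding pairing_def using int by (intro integral_cong_AE) auto
qed

text \<open>The dual value \<open>B\<close> is split as \<open>A - C\<close>, its interior and boundary parts. The two parts
  individually may differ between feasible functions, only \<open>A - C\<close> is common to them; but at the
  candidate both \<open>A\<close> and \<open>- C\<close> are nonnegative, so there no truncation at zero loses anything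
  when the two extended values are added.\<close>

lemma objective_le_dirichlet:
  assumes K: "linear_L2_operator \<Omega> K"
    and pq: "1 \<le> p" "inverse (ennreal p) + inverse q = 1" and "0 \<le> \<beta>"
    and D: "dirichlet_setting \<Omega> K G p q"
    and BV: "f \<in> BV \<Omega>" "fstar \<in> BV \<Omega>"
    and feasible: "AE z in surface_measure \<Omega>. K f z = K fstar z"
    and l: "l \<in> Lp_space (surface_measure \<Omega>) q" "Lp_norm (surface_measure \<Omega>) q l \<le> 1"
    and z: "AE y in BV_variation \<Omega> fstar. z_field \<Omega> K G l y \<bullet> BV_direction \<Omega> fstar y
        = w_tilde \<Omega> K G p y (BV_direction \<Omega> fstar y)"
    and n: "AE x in surface_measure \<Omega>. \<bar>z_normal \<Omega> K G l x\<bar> \<le> \<beta> * w_boundary \<Omega> K G p x"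
      "AE x in surface_measure \<Omega>. z_normal \<Omega> K G l x * BV_trace \<Omega> fstar x
        = - (\<beta> * w_boundary \<Omega> K G p x * \<bar>BV_trace \<Omega> fstar x\<bar>)"
  shows "objective \<Omega> K G p \<beta> fstar \<le> objective \<Omega> K G p \<beta> f"
proof -
  define A where "A g = (LINT y|BV_variation \<Omega> g. pairing \<Omega> l (K (gradG G y (BV_direction \<Omega> g y))))" for g
  define C where "C g = (LINT y|surface_measure \<Omega>. z_normal \<Omega> K G l y * BV_trace \<Omega> g y)" for g
  have kernel: "gradient_kernel_convention \<Omega> K G p"
    using D by (simp add: dirichlet_setting_def)
  have rep: "AE x in lebesgue_on \<Omega>. g x = dirichlet_representation \<Omega> G g x" if "g \<in> BV \<Omega>" for g
  proof -
    have "AE x in lebesgue_on \<Omega>.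
        integrable (BV_variation \<Omega> g) (\<lambda>y. gradG G y (BV_direction \<Omega> g y) x) \<and>
        integrable (surface_measure \<Omega>) (\<lambda>y. normalG \<Omega> G y x * BV_trace \<Omega> g y) \<and>
        g x = dirichlet_representation \<Omega> G g x"
      using D that by (simp add: dirichlet_setting_def)
    then show ?thesis by eventually_elim simp
  qed
  have interchange:
      "integrable (surface_measure \<Omega>) (\<lambda>z. l z * K (dirichlet_representation \<Omega> G g) z)"
      "integrable (BV_variation \<Omega> g) (\<lambda>y. pairing \<Omega> l (K (gradG G y (BV_direction \<Omega> g y))))"
      "integrable (surface_measure \<Omega>) (\<lambda>y. z_normal \<Omega> K G l y * BV_trace \<Omega> g y)"
      "pairing \<Omega> l (K (dirichlet_representation \<Omega> G g)) = A g - C g" if "g \<in> BV \<Omega>" for g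
    using D that l(1) by (auto simp: dirichlet_setting_def z_normal_def A_def C_def)
  have same: "A fstar - C fstar = A f - C f"
    using pairing_representation_eq[OF K rep rep interchange(1) interchange(1) feasible] BV
    by (simp add: interchange(4))
  have attained: "0 \<le> A fstar" "C fstar \<le> 0"
      "objective \<Omega> K G p \<beta> fstar = ennreal (A fstar) + ennreal (- C fstar)"
    using interior_duality_attained[OF pq l(1) kernel interchange(2)[OF BV(2)] z]
      boundary_duality_attained[OF \<open>0 \<le> \<beta>\<close> _ interchange(3)[OF BV(2)] n(2)]
    by (simp_all add: A_def C_def objective_def w_boundary_def)
  then have "objective \<Omega> K G p \<beta> fstar = ennreal (A f - C f)"
    using same by (simp flip: ennreal_plus)
  also have "\<dots> \<le> ennreal (A f) + ennreal (- C f)"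
  proof -
    \<comment> \<open>\<open>ennreal\<close> truncates negative reals to zero, so it is subadditive even when signs differ.\<close>
    have "ennreal (A f - C f) \<le> ennreal (max 0 (A f) + max 0 (- C f))"
      by (intro ennreal_leI) simp
    then show ?thesis by (auto simp: max_def ennreal_neg split: if_splits)
  qed
  also have "\<dots> \<le> objective \<Omega> K G p \<beta> f"
    unfolding objective_def A_def C_def
    by (intro add_mono interior_weak_duality[OF pq l kernel interchange(2)[OF BV(1)]]
        boundary_weak_duality[OF \<open>0 \<le> \<beta>\<close> interchange(3)[OF BV(1)] n(1)])
  finally show ?thesis .
qed

lemma objective_le_neumann:
  assumes K: "linear_L2_operator \<Omega> K"
    and pq: "1 \<le> p" "inverse (ennreal p) + inverse q = 1"
    and N: "neumann_setting \<Omega> K G p q"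
    and BV: "f \<in> BV \<Omega>" "fstar \<in> BV \<Omega>"
    and feasible: "AE z in surface_measure \<Omega>. K f z = K fstar z"
    and l: "l \<in> Lp_space (surface_measure \<Omega>) q" "Lp_norm (surface_measure \<Omega>) q l \<le> 1"
    and z: "AE y in BV_variation \<Omega> fstar. z_field \<Omega> K G l y \<bullet> BV_direction \<Omega> fstar y
        = w_tilde \<Omega> K G p y (BV_direction \<Omega> fstar y)"
  shows "objective \<Omega> K G p 0 fstar \<le> objective \<Omega> K G p 0 f"
proof -
  define A where "A g = (LINT y|BV_variation \<Omega> g. pairing \<Omega> l (K (gradG G y (BV_direction \<Omega> g y))))" for g
  have kernel: "gradient_kernel_convention \<Omega> K G p"
    using N by (simp add: neumann_setting_def)
  have rep: "AE x in lebesgue_on \<Omega>. g x = neumann_representation \<Omega> G g x" if "g \<in> BV \<Omega>" for g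
  proof -
    have "AE x in lebesgue_on \<Omega>.
        integrable (BV_variation \<Omega> g) (\<lambda>y. gradG G y (BV_direction \<Omega> g y) x) \<and>
        g x = neumann_representation \<Omega> G g x"
      using N that by (simp add: neumann_setting_def)
    then show ?thesis by eventually_elim simp
  qed
  have "AE z in surface_measure \<Omega>. K (\<lambda>_. 1) z = 0"
    using N by (simp add: neumann_setting_def)
  then have const: "pairing \<Omega> l (K (\<lambda>_. 1)) = 0"
    unfolding pairing_def by (intro integral_eq_zero_AE) auto
  have interchange:
      "integrable (surface_measure \<Omega>) (\<lambda>z. l z * K (neumann_representation \<Omega> G g) z)"
      "integrable (BV_variation \<Omega> g) (\<lambda>y. pairing \<Omega> l (K (gradG G y (BV_direction \<Omega> g y))))"
      "pairing \<Omega> l (K (neumann_representation \<Omega> G g)) = A g" if "g \<in> BV \<Omega>" for g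
    using N that l(1) const by (auto simp: neumann_setting_def A_def)
  have same: "A fstar = A f"
    using pairing_representation_eq[OF K rep rep interchange(1) interchange(1) feasible] BV
    by (simp add: interchange(3))
  have "objective \<Omega> K G p 0 fstar = ennreal (A fstar)"
    using interior_duality_attained(1)[OF pq l(1) kernel interchange(2)[OF BV(2)] z]
    by (simp add: A_def objective_def)
  also have "\<dots> \<le> objective \<Omega> K G p 0 f"
    using interior_weak_duality[OF pq l kernel interchange(2)[OF BV(1)]]
    by (simp add: same A_def[of f] objective_def)
  finally show ?thesis .
qed

theorem corollary4p5:
  fixes \<Omega> :: "(real^2) set"
    and K :: "(real^2 \<Rightarrow> real) \<Rightarrow> real^2 \<Rightarrow> real"
    and G :: "real^2 \<Rightarrow> real^2 \<Rightarrow> real"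
    and p \<beta> :: real and q :: ennreal
    and fstar :: "real^2 \<Rightarrow> real"
  assumes "bounded_lipschitz_domain \<Omega>"
    and "linear_L2_operator \<Omega> K"
    and "1 \<le> p" and "inverse (ennreal p) + inverse q = 1"
    and "0 \<le> \<beta>"
    and "dirichlet_setting \<Omega> K G p q \<or> (neumann_setting \<Omega> K G p q \<and> \<beta> = 0)"
    and "fstar \<in> BV \<Omega>"
    and "\<exists>l \<in> Lp_space (surface_measure \<Omega>) q.
           Lp_norm (surface_measure \<Omega>) q l \<le> 1 \<and>
           (AE y in BV_variation \<Omega> fstar.
              z_field \<Omega> K G l y \<bullet> BV_direction \<Omega> fstar y
                = w_tilde \<Omega> K G p y (BV_direction \<Omega> fstar y)) \<and>
           (AE x in surface_measure \<Omega>. \<bar>z_normal \<Omega> K G l x\<bar> \<le> \<beta> * w_boundary \<Omega> K G p x) \<and>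
           (AE x in surface_measure \<Omega>. z_normal \<Omega> K G l x * BV_trace \<Omega> fstar x
                = - (\<beta> * w_boundary \<Omega> K G p x * \<bar>BV_trace \<Omega> fstar x\<bar>))"
  shows "is_arg_min (objective \<Omega> K G p \<beta>)
           (\<lambda>f. f \<in> BV \<Omega> \<and> (AE z in surface_measure \<Omega>. K f z = K fstar z)) fstar"
proof -
  obtain l where l: "l \<in> Lp_space (surface_measure \<Omega>) q" "Lp_norm (surface_measure \<Omega>) q l \<le> 1"
    and z: "AE y in BV_variation \<Omega> fstar. z_field \<Omega> K G l y \<bullet> BV_direction \<Omega> fstar y
        = w_tilde \<Omega> K G p y (BV_direction \<Omega> fstar y)"
    and n: "AE x in surface_measure \<Omega>. \<bar>z_normal \<Omega> K G l x\<bar> \<le> \<beta> * w_boundary \<Omega> K G p x"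
      "AE x in surface_measure \<Omega>. z_normal \<Omega> K G l x * BV_trace \<Omega> fstar x
        = - (\<beta> * w_boundary \<Omega> K G p x * \<bar>BV_trace \<Omega> fstar x\<bar>)"
    using assms(8) by blast
  have "objective \<Omega> K G p \<beta> fstar \<le> objective \<Omega> K G p \<beta> f"
    if "f \<in> BV \<Omega>" "AE z in surface_measure \<Omega>. K f z = K fstar z" for f
    using assms(6)
  proof
    assume "dirichlet_setting \<Omega> K G p q"
    then show ?thesis
      by (rule objective_le_dirichlet[OF assms(2-5) _ that(1) assms(7) that(2) l z n])
  next
    assume "neumann_setting \<Omega> K G p q \<and> \<beta> = 0"
    then show ?thesis
      using objective_le_neumann[OF assms(2-4) _ that(1) assms(7) that(2) l z] by simp
  qed
  then show ?thesis
    using assms(7) by (auto simp: is_arg_min_def not_less)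
qed

end
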